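(* Let $G$ be a connected simple graph with $n\ge 2$ vertices and $m$ edges, with maximum vertex degree $\Delta(G)$ and minimum vertex degree $\delta(G)$, and let $q_1\ge\dots\ge q_n\ge 0$ be its signless Laplacian eigenvalues, $L_k(G)=\sum_{i=0}^{k-1}q_{n-i}$. If $1\le k\le n-1$, then $$L_k(G)\ge \frac{2mk}{n}-\frac{\sqrt{mk(n-k)\big(2\Delta(G)\delta(G)(n-2m)+m(\Delta(G)+\delta(G))^2\big)}}{n\sqrt{\Delta(G)\delta(G)}},$$ with equality if and only if $G\cong K_n$ and $k=n-1$. Moreover, for $k=n$ equality always holds (both sides equal $2m$).
   Context: The signless Laplacian matrix of $G$ is $Q(G)=D(G)+A(G)$, where $A(G)$ is the adjacency matrix and $D(G)$ the diagonal matrix of vertex degrees. $K_n$ is the complete graph on $n$ vertices. *)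

theory Defs
  imports
    Graph_Theory.Graph_Theory
    Jordan_Normal_Form.Char_Poly
begin

text \<open>
  Simple graphs are rendered by the locale \<^locale>\<open>graph\<close>: finite loop-free symmetric digraphs without
  parallel arcs. An undirected edge \<open>uv\<close> is the pair of arcs \<open>(u,v)\<close>, \<open>(v,u)\<close>, so the edges are the
  unordered pairs below, and the degree of \<open>v\<close> is \<open>out_degree G v\<close>.
\<close>

definition edges :: "('a,'b) pre_digraph \<Rightarrow> 'a set set" where
  "edges G = {{u, v} |u v. u \<rightarrow>\<^bsub>G\<^esub> v}"

definition max_degree :: "('a,'b) pre_digraph \<Rightarrow> nat" where
  "max_degree G = Max (out_degree G ` verts G)"

definition min_degree :: "('a,'b) pre_digraph \<Rightarrow> nat" where
  "min_degree G = Min (out_degree G ` verts G)"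

definition complete_graph :: "nat \<Rightarrow> (nat, nat \<times> nat) pre_digraph" where
  "complete_graph n = with_proj \<lparr> pverts = {..<n}, parcs = {(i, j). i < n \<and> j < n \<and> i \<noteq> j} \<rparr>"

lemma complete_digraph_complete_graph: "complete_digraph n (complete_graph n)"
  unfolding complete_graph_def complete_digraph_pair_def by auto

text \<open>
  The list \<open>vs\<close> enumerates the vertices of \<open>G\<close> without repetition; it fixes the order of rows and
  columns.
\<close>

definition adjacency_mat :: "('a,'b) pre_digraph \<Rightarrow> 'a list \<Rightarrow> real mat" where
  "adjacency_mat G vs =
     mat (length vs) (length vs) (\<lambda>(i, j). if vs ! i \<rightarrow>\<^bsub>G\<^esub> vs ! j then 1 else 0)"

definition degree_mat :: "('a,'b) pre_digraph \<Rightarrow> 'a list \<Rightarrow> real mat" where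
  "degree_mat G vs =
     mat (length vs) (length vs) (\<lambda>(i, j). if i = j then real (out_degree G (vs ! i)) else 0)"

definition signless_laplacian_mat :: "('a,'b) pre_digraph \<Rightarrow> 'a list \<Rightarrow> real mat" where
  "signless_laplacian_mat G vs = degree_mat G vs + adjacency_mat G vs"

text \<open>
  The eigenvalues in nonincreasing order, repeated by multiplicity as roots of the characteristic
  polynomial. The matrix is real symmetric, so all its \<open>length vs\<close> eigenvalues are real.
  The index \<open>i\<close> of \<open>signless_q G vs i\<close> starts at 1.
\<close>

definition signless_laplacian_eigenvalues :: "('a,'b) pre_digraph \<Rightarrow> 'a list \<Rightarrow> real list" where
  "signless_laplacian_eigenvalues G vs =
     rev (sorted_list_of_multiset (proots (char_poly (signless_laplacian_mat G vs))))"

definition signless_q :: "('a,'b) pre_digraph \<Rightarrow> 'a list \<Rightarrow> nat \<Rightarrow> real" where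
  "signless_q G vs i = signless_laplacian_eigenvalues G vs ! (i - 1)"

definition signless_L :: "('a,'b) pre_digraph \<Rightarrow> 'a list \<Rightarrow> nat \<Rightarrow> real" where
  "signless_L G vs k = (\<Sum>i<k. signless_q G vs (card (verts G) - i))"

end

theory Submission
  imports Defs "Jordan_Normal_Form.Schur_Decomposition"
begin

text \<open>
  Write \<open>x\<^sub>1 \<le> \<dots> \<le> x\<^sub>n\<close> for the eigenvalues, \<open>L\<close> for the sum of the first \<open>k\<close> and \<open>d\<^sub>v\<close> for the degrees.
  The traces of \<open>Q\<close> and \<open>Q\<^sup>2\<close> give \<open>\<Sum>x\<^sub>i = 2m\<close> and \<open>\<Sum>x\<^sub>i\<^sup>2 = \<Sum>d\<^sub>v\<^sup>2 + 2m\<close>. Cauchy-Schwarz, applied separately to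
  the \<open>k\<close> smallest and the \<open>n - k\<close> largest eigenvalues, bounds \<open>(nL - 2mk)\<^sup>2\<close> by
  \<open>k(n - k)(n \<Sum>x\<^sub>i\<^sup>2 - 4m\<^sup>2)\<close>, and summing \<open>(d\<^sub>v - \<delta>)(d\<^sub>v - \<Delta>) \<le> 0\<close> bounds \<open>\<Sum>d\<^sub>v\<^sup>2\<close>.

  Equality forces the eigenvalues in each of the two groups to coincide, so \<open>(Q - s)(Q - t) = 0\<close> for
  some \<open>s\<close>, \<open>t\<close>. As \<open>Q\<close> is entrywise nonnegative, two non-adjacent vertices then have no common
  neighbour, and a connected graph with this property is complete. For \<open>K\<^sub>n\<close> the spectrum is
  \<open>2n - 2\<close> once and \<open>n - 2\<close> otherwise, and the bound is attained exactly at \<open>k = n - 1\<close>.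
\<close>

section \<open>Spectra of real symmetric matrices\<close>

text \<open>For an eigenvector \<open>v\<close>, the sesquilinear form of \<open>A\<close> at
  \<open>v\<close> is \<open>a\<close> times the positive squared norm of \<open>v\<close>. Symmetry
  makes that form its own conjugate, so \<open>a\<close> is real.\<close>

lemma eigenvalue_real_symmetric:
  fixes A :: "real mat"
  assumes A: "A \<in> carrier_mat n n"
    and sym: "\<And>i j. i < n \<Longrightarrow> j < n \<Longrightarrow> A $$ (i, j) = A $$ (j, i)"
    and ev: "eigenvalue (map_mat complex_of_real A) a"
  shows "a \<in> \<real>"
proof -
  let ?A = "map_mat complex_of_real A"
  obtain v where v: "v \<in> carrier_vec n" "v \<noteq> 0\<^sub>v n" and Av: "?A *\<^sub>v v = a \<cdot>\<^sub>v v"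
    using ev A unfolding eigenvalue_def eigenvector_def by auto
  define N where "N = (\<Sum>i<n. (cmod (v $ i))\<^sup>2)"
  obtain i where i: "i < n" "v $ i \<noteq> 0"
    using v by (metis carrier_vecD eq_vecI index_zero_vec)
  have "(cmod (v $ i))\<^sup>2 \<le> N"
    unfolding N_def by (rule member_le_sum) (use i in auto)
  moreover have "0 < (cmod (v $ i))\<^sup>2"
    using i by simp
  ultimately have N: "N > 0"
    by linarith
  define c where "c = (\<Sum>i<n. \<Sum>j<n. cnj (v $ i) * of_real (A $$ (i, j)) * v $ j)"
  have row: "(\<Sum>j<n. of_real (A $$ (i, j)) * v $ j) = a * v $ i" if "i < n" for i
    using arg_cong[OF Av, of "\<lambda>w. w $ i"] that A v
    by (simp add: scalar_prod_def atLeast0LessThan)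
  have "c = (\<Sum>i<n. cnj (v $ i) * (\<Sum>j<n. of_real (A $$ (i, j)) * v $ j))"
    unfolding c_def by (simp add: sum_distrib_left mult.assoc)
  also have "\<dots> = (\<Sum>i<n. a * of_real ((cmod (v $ i))\<^sup>2))"
    by (rule sum.cong) (simp_all add: row complex_norm_square del: of_real_power)
  also have "\<dots> = a * of_real N"
    by (simp add: N_def sum_distrib_left)
  finally have c: "c = a * of_real N" .
  have "cnj c = (\<Sum>i<n. \<Sum>j<n. cnj (v $ j) * of_real (A $$ (j, i)) * v $ i)"
    unfolding c_def cnj_sum by (intro sum.cong) (auto simp: sym)
  also have "\<dots> = c"
    unfolding c_def by (rule sum.swap)
  finally have "cnj a * of_real N = a * of_real N"
    unfolding c by simp
  then show ?thesis
    using N by (simp add: Reals_cnj_iff)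
qed

text \<open>Over the complex numbers the polynomial splits with real roots only; the factorization
  pulls back because the embedding of real polynomials is injective.\<close>

lemma char_poly_real_symmetric_splits:
  fixes A :: "real mat"
  assumes A: "A \<in> carrier_mat n n"
    and sym: "\<And>i j. i < n \<Longrightarrow> j < n \<Longrightarrow> A $$ (i, j) = A $$ (j, i)"
  obtains es where "char_poly A = (\<Prod>e\<leftarrow>es. [:- e, 1:])" "length es = n"
proof -
  let ?A = "map_mat complex_of_real A"
  interpret map_inj: map_poly_inj_comm_ring_hom complex_of_real ..
  have A': "?A \<in> carrier_mat n n"
    using A by simp
  obtain as where as: "char_poly ?A = (\<Prod>a\<leftarrow>as. [:- a, 1:])" "length as = n"
    using char_poly_factorized[OF A'] by blast
  have real: "a \<in> \<real>" if "a \<in> set as" for a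
  proof (rule eigenvalue_real_symmetric[OF A sym])
    show "eigenvalue ?A a"
      unfolding eigenvalue_root_char_poly[OF A'] as(1)
      using that by (simp add: poly_prod_list prod_list_zero_iff image_iff)
  qed auto
  define es where "es = map Re as"
  have "as = map of_real es"
    unfolding es_def using real by (auto simp: comp_def intro!: map_idI[symmetric])
  then have "map_poly complex_of_real (char_poly A)
      = map_poly complex_of_real (\<Prod>e\<leftarrow>es. [:- e, 1:])"
    unfolding of_real_hom.char_poly_hom[OF A, symmetric] as(1)
    by (simp add: map_inj.hom_prod_list comp_def)
  then have "char_poly A = (\<Prod>e\<leftarrow>es. [:- e, 1:])"
    by (rule map_inj.injectivity)
  moreover have "length es = n"
    by (simp add: es_def as)
  ultimately show ?thesis
    using that by blast
qed

lemma proots_prod_linear_factors: "proots (\<Prod>e\<leftarrow>es. [:- e, 1:]) = mset es"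
  for es :: "'a::idom list"
proof (induction es)
  case (Cons e es)
  have "(\<Prod>e\<leftarrow>es. [:- e, 1:]) \<noteq> 0"
    by (auto simp: prod_list_zero_iff)
  then have "proots ([:- e, 1:] * (\<Prod>e\<leftarrow>es. [:- e, 1:])) = {#e#} + mset es"
    by (subst proots_mult) (simp_all add: Cons.IH)
  then show ?case
    by simp
qed simp

section \<open>Triangular products, and traces under similarity\<close>

lemma upper_triangular_diag_mult:
  fixes A B :: "'a::semiring_0 mat"
  assumes "A \<in> carrier_mat n n" "B \<in> carrier_mat n n" "upper_triangular A" "upper_triangular B"
    and "i < n"
  shows "(A * B) $$ (i, i) = A $$ (i, i) * B $$ (i, i)"
proof -
  have "(A * B) $$ (i, i) = (\<Sum>l<n. A $$ (i, l) * B $$ (l, i))"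
    using assms by (simp add: scalar_prod_def atLeast0LessThan)
  also have "\<dots> = (\<Sum>l<n. if l = i then A $$ (i, i) * B $$ (i, i) else 0)"
  proof (rule sum.cong)
    fix l assume "l \<in> {..<n}"
    then consider "l < i" | "l = i" | "i < l" "l < n"
      by fastforce
    then show "A $$ (i, l) * B $$ (l, i) = (if l = i then A $$ (i, i) * B $$ (i, i) else 0)"
      using assms by cases (auto dest: upper_triangularD)
  qed simp
  also have "\<dots> = A $$ (i, i) * B $$ (i, i)"
    using \<open>i < n\<close> by simp
  finally show ?thesis .
qed

lemma upper_triangular_mult:
  fixes A B :: "'a::semiring_0 mat"
  assumes "A \<in> carrier_mat n n" "B \<in> carrier_mat n n" "upper_triangular A" "upper_triangular B"
  shows "upper_triangular (A * B)"
proof (rule upper_triangularI)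
  fix i j assume ji: "j < i" "i < dim_row (A * B)"
  have "A $$ (i, l) * B $$ (l, j) = 0" if "l < n" for l
    using assms that ji by (cases "l < i") (auto simp: upper_triangularD)
  then show "(A * B) $$ (i, j) = 0"
    using assms ji by (simp add: scalar_prod_def)
qed

text \<open>Cyclicity of the trace, with the trace written as a diagonal sum.\<close>

lemma sum_mat_mult_diag_commute:
  fixes A B :: "'a::comm_semiring_0 mat"
  assumes "A \<in> carrier_mat n n" "B \<in> carrier_mat n n"
  shows "(\<Sum>i<n. (A * B) $$ (i, i)) = (\<Sum>i<n. (B * A) $$ (i, i))"
proof -
  have "(\<Sum>i<n. (A * B) $$ (i, i)) = (\<Sum>i<n. \<Sum>l<n. A $$ (i, l) * B $$ (l, i))"
    using assms by (simp add: scalar_prod_def atLeast0LessThan)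
  also have "\<dots> = (\<Sum>l<n. \<Sum>i<n. B $$ (l, i) * A $$ (i, l))"
    by (subst sum.swap) (simp add: mult.commute)
  also have "\<dots> = (\<Sum>i<n. (B * A) $$ (i, i))"
    using assms by (simp add: scalar_prod_def atLeast0LessThan)
  finally show ?thesis .
qed

lemma sum_diag_similar:
  fixes A B :: "'a::comm_semiring_1 mat"
  assumes A: "A \<in> carrier_mat n n" and sim: "similar_mat_wit A B P Q"
  shows "(\<Sum>i<n. A $$ (i, i)) = (\<Sum>i<n. B $$ (i, i))"
proof -
  note D = similar_mat_witD2[OF A sim]
  have "(\<Sum>i<n. A $$ (i, i)) = (\<Sum>i<n. (P * (B * Q)) $$ (i, i))"
    using D by (simp add: assoc_mult_mat[of _ n n _ n _ n])
  also have "\<dots> = (\<Sum>i<n. ((B * Q) * P) $$ (i, i))"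
    by (rule sum_mat_mult_diag_commute) (use D in auto)
  also have "(B * Q) * P = B"
    using D by (simp add: assoc_mult_mat[of _ n n _ n _ n])
  finally show ?thesis .
qed

text \<open>The inner \<open>Q * P\<close> cancels. Together with
  \<open>similar_mat_wit_minus_smult_one\<close> this carries quadratic polynomials in
  \<open>A\<close> to the triangular side with the same witnesses.\<close>

lemma similar_mat_wit_mult:
  assumes A: "A \<in> carrier_mat n n" "A' \<in> carrier_mat n n"
    and sim: "similar_mat_wit A B P Q" "similar_mat_wit A' B' P Q"
  shows "similar_mat_wit (A * A') (B * B') P Q"
proof -
  note D = similar_mat_witD2[OF A(1) sim(1)] and D' = similar_mat_witD2[OF A(2) sim(2)]
  note carr = D(5-7) D'(5)
  have "Q * (P * (B' * Q)) = (Q * P) * (B' * Q)"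
    by (rule assoc_mult_mat[symmetric]) (use carr in auto)
  then have cancel: "Q * (P * (B' * Q)) = B' * Q"
    unfolding D(2) using carr by simp
  have "A * A' = P * B * Q * (P * B' * Q)"
    using D(3) D'(3) by simp
  also have "\<dots> = P * (B * (Q * (P * (B' * Q))))"
    using carr by (simp add: assoc_mult_mat[of _ n n _ n _ n])
  also have "\<dots> = P * (B * B') * Q"
    unfolding cancel using carr by (simp add: assoc_mult_mat[of _ n n _ n _ n])
  finally show ?thesis
    by (rule similar_mat_witI[OF D(1,2)]) (use D D' in auto)
qed

lemma similar_mat_wit_minus_smult_one:
  fixes A :: "'a::comm_ring_1 mat"
  assumes A: "A \<in> carrier_mat n n" and sim: "similar_mat_wit A B P Q"
  shows "similar_mat_wit (A - s \<cdot>\<^sub>m 1\<^sub>m n) (B - s \<cdot>\<^sub>m 1\<^sub>m n) P Q"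
proof -
  note D = similar_mat_witD2[OF A sim]
  have "P * (B - s \<cdot>\<^sub>m 1\<^sub>m n) * Q = (P * B - P * (s \<cdot>\<^sub>m 1\<^sub>m n)) * Q"
    using D by (subst mult_minus_distrib_mat[of _ n n _ n]) auto
  also have "P * (s \<cdot>\<^sub>m 1\<^sub>m n) = s \<cdot>\<^sub>m P"
    using D by (subst mult_smult_distrib[of _ n n _ n]) auto
  also have "(P * B - s \<cdot>\<^sub>m P) * Q = P * B * Q - s \<cdot>\<^sub>m P * Q"
    using D by (subst minus_mult_distrib_mat[of _ n n _ _ n]) auto
  also have "s \<cdot>\<^sub>m P * Q = s \<cdot>\<^sub>m 1\<^sub>m n"
    using D by (subst mult_smult_assoc_mat[of _ n n _ n]) auto
  finally show ?thesis
    using D by (intro similar_mat_witI[OF D(1,2)]) auto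
qed

text \<open>By symmetry the squared Frobenius norm is the trace of \<open>A * A\<close>, which
  similarity preserves; squaring a triangular matrix squares its diagonal.\<close>

lemma sum_squares_symmetric_similar_triangular:
  fixes A :: "real mat"
  assumes A: "A \<in> carrier_mat n n"
    and sym: "\<And>i j. i < n \<Longrightarrow> j < n \<Longrightarrow> A $$ (i, j) = A $$ (j, i)"
    and sim: "similar_mat_wit A T P Q" and T: "upper_triangular T"
  shows "(\<Sum>i<n. \<Sum>j<n. (A $$ (i, j))\<^sup>2) = (\<Sum>i<n. (T $$ (i, i))\<^sup>2)"
proof -
  have "(\<Sum>i<n. \<Sum>j<n. (A $$ (i, j))\<^sup>2) = (\<Sum>i<n. (A * A) $$ (i, i))"
    using A sym by (auto simp: scalar_prod_def atLeast0LessThan power2_eq_square intro!: sum.cong)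
  also have "\<dots> = (\<Sum>i<n. (T * T) $$ (i, i))"
    by (rule sum_diag_similar[OF _ similar_mat_wit_mult[OF A A sim sim]]) (use A in auto)
  also have "\<dots> = (\<Sum>i<n. (T $$ (i, i))\<^sup>2)"
    using similar_mat_witD2[OF A sim] T
    by (intro sum.cong) (auto simp: upper_triangular_diag_mult[of _ n] power2_eq_square
        simp del: index_mult_mat)
  finally show ?thesis .
qed

text \<open>The expansion shows the product to be symmetric when \<open>A\<close> is, and exposes
  its off-diagonal entries for the graph argument.\<close>

lemma index_quadratic_mat:
  fixes A :: "'a::comm_ring_1 mat"
  assumes A: "A \<in> carrier_mat n n" and ij: "i < n" "j < n"
  shows "((A - s \<cdot>\<^sub>m 1\<^sub>m n) * (A - t \<cdot>\<^sub>m 1\<^sub>m n)) $$ (i, j)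
    = (\<Sum>l<n. A $$ (i, l) * A $$ (l, j)) - (s + t) * A $$ (i, j) + (if i = j then s * t else 0)"
proof -
  have "((A - s \<cdot>\<^sub>m 1\<^sub>m n) * (A - t \<cdot>\<^sub>m 1\<^sub>m n)) $$ (i, j)
      = (\<Sum>l<n. (A $$ (i, l) - (if i = l then s else 0)) * (A $$ (l, j) - (if l = j then t else 0)))"
    using A ij by (auto simp: scalar_prod_def atLeast0LessThan intro!: sum.cong)
  also have "\<dots> = (\<Sum>l<n. A $$ (i, l) * A $$ (l, j)
      - (if l = j then t * A $$ (i, j) else 0)
      - (if i = l then s * A $$ (i, j) else 0)
      + (if l = i then (if i = j then s * t else 0) else 0))"
    by (intro sum.cong) (auto simp: algebra_simps)
  also have "\<dots> = (\<Sum>l<n. A $$ (i, l) * A $$ (l, j)) - t * A $$ (i, j) - s * A $$ (i, j)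
      + (if i = j then s * t else 0)"
    using ij by (simp add: sum.distrib sum_subtractf)
  finally show ?thesis
    by (simp add: algebra_simps)
qed

section \<open>Power sums of eigenvalues and quadratic annihilators\<close>

locale symmetric_spectrum =
  fixes A :: "real mat" and n :: nat and es :: "real list"
  assumes A: "A \<in> carrier_mat n n"
    and sym: "\<And>i j. i < n \<Longrightarrow> j < n \<Longrightarrow> A $$ (i, j) = A $$ (j, i)"
    and cp: "char_poly A = (\<Prod>e\<leftarrow>es. [:- e, 1:])"
begin

text \<open>The Schur decomposition takes the eigenvalues in a prescribed order, so the diagonal is
  \<open>es\<close> itself and not just a permutation of it.\<close>

lemma triangularization:
  obtains T P Q where "similar_mat_wit A T P Q" "upper_triangular T" "T \<in> carrier_mat n n"
    "es = map (\<lambda>i. T $$ (i, i)) [0..<n]"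
proof -
  obtain T P Q where "schur_decomposition A es = (T, P, Q)"
    by (cases "schur_decomposition A es")
  from schur_decomposition[OF A cp this]
  have *: "similar_mat_wit A T P Q" "upper_triangular T" "diag_mat T = es"
    by auto
  moreover have "T \<in> carrier_mat n n"
    using similar_mat_witD2[OF A *(1)] by simp
  ultimately show ?thesis
    using that by (auto simp: diag_mat_def)
qed

lemma sum_eigenvalues: "sum_list es = (\<Sum>i<n. A $$ (i, i))"
proof -
  obtain T P Q where "similar_mat_wit A T P Q" "es = map (\<lambda>i. T $$ (i, i)) [0..<n]"
    by (rule triangularization)
  then show ?thesis
    by (simp add: sum_diag_similar[OF A] interv_sum_list_conv_sum_set_nat atLeast0LessThan)
qed

lemma sum_eigenvalues_squared: "(\<Sum>e\<leftarrow>es. e\<^sup>2) = (\<Sum>i<n. \<Sum>j<n. (A $$ (i, j))\<^sup>2)"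
proof -
  obtain T P Q where "similar_mat_wit A T P Q" "upper_triangular T"
      "es = map (\<lambda>i. T $$ (i, i)) [0..<n]"
    by (rule triangularization)
  then show ?thesis
    by (simp add: sum_squares_symmetric_similar_triangular[OF A sym] comp_def
        interv_sum_list_conv_sum_set_nat atLeast0LessThan)
qed

text \<open>Stands in for diagonalizability: the product is symmetric and similar to a triangular
  matrix with diagonal entries \<open>(e - s) * (e - t)\<close>, so its squared Frobenius norm is
  the sum of their squares.\<close>

lemma quadratic_annihilates_iff:
  "(A - s \<cdot>\<^sub>m 1\<^sub>m n) * (A - t \<cdot>\<^sub>m 1\<^sub>m n) = 0\<^sub>m n n \<longleftrightarrow> (\<forall>e\<in>set es. e = s \<or> e = t)"
proof -
  obtain T P Q where sim: "similar_mat_wit A T P Q" and T: "upper_triangular T" "T \<in> carrier_mat n n"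
      and es: "es = map (\<lambda>i. T $$ (i, i)) [0..<n]"
    by (rule triangularization)
  define M N where "M = (A - s \<cdot>\<^sub>m 1\<^sub>m n) * (A - t \<cdot>\<^sub>m 1\<^sub>m n)"
    and "N = (T - s \<cdot>\<^sub>m 1\<^sub>m n) * (T - t \<cdot>\<^sub>m 1\<^sub>m n)"
  have ut: "upper_triangular (T - r \<cdot>\<^sub>m 1\<^sub>m n)" for r
    using T by (intro upper_triangularI) (auto dest: upper_triangularD)
  have MN: "similar_mat_wit M N P Q" and M: "M \<in> carrier_mat n n"
    unfolding M_def N_def using A
    by (auto intro!: similar_mat_wit_mult[of _ n] similar_mat_wit_minus_smult_one[OF A sim])
  note D = similar_mat_witD2[OF M MN]
  have utN: "upper_triangular N"
    unfolding N_def by (rule upper_triangular_mult[of _ n]) (use T ut in auto)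
  have diagN: "N $$ (i, i) = (T $$ (i, i) - s) * (T $$ (i, i) - t)" if "i < n" for i
    unfolding N_def using that T ut by (subst upper_triangular_diag_mult[of _ n]) auto
  \<comment> \<open>A product of symmetric matrices need not be symmetric; these two factors
    commute, and the entry formula is symmetric in \<open>i\<close> and \<open>j\<close>.\<close>
  have symM: "M $$ (i, j) = M $$ (j, i)" if "i < n" "j < n" for i j
    unfolding M_def index_quadratic_mat[OF A that] index_quadratic_mat[OF A that(2,1)]
    using that by (auto simp: sym mult.commute intro!: sum.cong)
  have sq: "(\<Sum>i<n. \<Sum>j<n. (M $$ (i, j))\<^sup>2) = (\<Sum>i<n. (N $$ (i, i))\<^sup>2)"
    by (rule sum_squares_symmetric_similar_triangular[OF M symM MN utN])
  have "M = 0\<^sub>m n n \<longleftrightarrow> (\<forall>i<n. N $$ (i, i) = 0)"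
  proof
    assume "M = 0\<^sub>m n n"
    then have "(\<Sum>i<n. (N $$ (i, i))\<^sup>2) = 0"
      unfolding sq[symmetric] by simp
    then show "\<forall>i<n. N $$ (i, i) = 0"
      by (subst (asm) sum_nonneg_eq_0_iff) auto
  next
    assume "\<forall>i<n. N $$ (i, i) = 0"
    then have "(\<Sum>i<n. \<Sum>j<n. (M $$ (i, j))\<^sup>2) = 0"
      unfolding sq by simp
    then have "\<forall>i<n. \<forall>j<n. M $$ (i, j) = 0"
      by (subst (asm) sum_nonneg_eq_0_iff, simp, simp add: sum_nonneg)
         (subst (asm) sum_nonneg_eq_0_iff, auto)
    then show "M = 0\<^sub>m n n"
      using M by auto
  qed
  also have "\<dots> \<longleftrightarrow> (\<forall>e\<in>set es. e = s \<or> e = t)"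
    by (auto simp: es diagN)
  finally show ?thesis
    unfolding M_def .
qed

end

section \<open>Partial sums of real sequences\<close>

text \<open>The exact defect in Cauchy-Schwarz: each group is compared with its own mean. The right
  side is nonnegative and vanishes only if both groups are constant, which serves the bound and its
  equality case alike.\<close>

lemma partial_sum_deviation:
  fixes x :: "nat \<Rightarrow> real"
  assumes k: "0 < k" "k < n"
  defines "L \<equiv> \<Sum>i<k. x i" and "S \<equiv> \<Sum>i<n. x i"
  shows "k * (real n - k) * (n * (\<Sum>i<n. (x i)\<^sup>2) - S\<^sup>2) - (n * L - k * S)\<^sup>2
    = n * k * (real n - k)
      * ((\<Sum>i<k. (x i - L / k)\<^sup>2) + (\<Sum>i=k..<n. (x i - (S - L) / (real n - k))\<^sup>2))"
proof -
  have dev: "(\<Sum>i\<in>I. (x i - sum x I / card I)\<^sup>2) = (\<Sum>i\<in>I. (x i)\<^sup>2) - (sum x I)\<^sup>2 / card I"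
    if "finite I" "I \<noteq> {}" for I :: "nat set"
  proof -
    let ?c = "sum x I / card I"
    have "(\<Sum>i\<in>I. (x i - ?c)\<^sup>2) = (\<Sum>i\<in>I. (x i)\<^sup>2 - 2 * ?c * x i + ?c\<^sup>2)"
      by (rule sum.cong) (simp_all add: power2_diff)
    also have "\<dots> = (\<Sum>i\<in>I. (x i)\<^sup>2) - 2 * ?c * sum x I + card I * ?c\<^sup>2"
      by (simp only: sum.distrib sum_subtractf sum_distrib_left[symmetric] sum_constant)
    also have "card I * ?c\<^sup>2 = ?c * sum x I"
      using that by (simp add: power2_eq_square)
    finally show ?thesis
      by (simp add: power2_eq_square)
  qed
  have split: "sum f {..<n} = sum f {..<k} + sum f {k..<n}" for f :: "nat \<Rightarrow> real"
    using k by (metis lessThan_atLeast0 less_imp_le_nat sum.atLeastLessThan_concat zero_le)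
  have hi: "sum x {k..<n} = S - L"
    unfolding S_def L_def by (simp add: split)
  have e1: "(\<Sum>i<k. (x i - L / k)\<^sup>2) = (\<Sum>i<k. (x i)\<^sup>2) - L\<^sup>2 / k"
    using dev[of "{..<k}"] k by (simp add: L_def lessThan_empty_iff)
  have e2: "(\<Sum>i=k..<n. (x i - (S - L) / (real n - k))\<^sup>2)
      = (\<Sum>i=k..<n. (x i)\<^sup>2) - (S - L)\<^sup>2 / (real n - k)"
    using dev[of "{k..<n}"] k by (simp add: hi of_nat_diff)
  \<comment> \<open>With \<open>n = k + d\<close> the claim is a rational identity with nonzero
    denominators \<open>k\<close> and \<open>d\<close>.\<close>
  obtain d where d: "n = k + d" "d > 0"
    using k less_imp_add_positive by blast
  then have n: "real n - real k = d" "real n = k + real d"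
    by simp_all
  have "k * real d * ((k + real d) * (X + Y) - S\<^sup>2) - ((k + real d) * L - k * S)\<^sup>2
      = (k + real d) * k * d * (X - L\<^sup>2 / k + (Y - (S - L)\<^sup>2 / d))" for X Y :: real
    using k d by (simp add: field_simps power2_eq_square)
  then show ?thesis
    unfolding e1 e2 unfolding split n(1) unfolding n(2) .
qed

text \<open>A reverse Cauchy-Schwarz inequality, to be applied to the degrees with \<open>a\<close>
  and \<open>b\<close> the extreme degrees.\<close>

lemma sum_squares_le_of_bounds:
  fixes d :: "'a \<Rightarrow> real"
  assumes "finite V" "\<And>v. v \<in> V \<Longrightarrow> a \<le> d v" "\<And>v. v \<in> V \<Longrightarrow> d v \<le> b" "0 \<le> a" "0 \<le> b"
  shows "4 * (a * b) * card V * (\<Sum>v\<in>V. (d v)\<^sup>2) \<le> ((a + b) * sum d V)\<^sup>2"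
proof -
  have "(\<Sum>v\<in>V. (d v - a) * (d v - b)) \<le> 0"
    by (rule sum_nonpos) (use assms in \<open>auto intro: mult_nonneg_nonpos\<close>)
  also have "(\<Sum>v\<in>V. (d v - a) * (d v - b)) = (\<Sum>v\<in>V. (d v)\<^sup>2) - (a + b) * sum d V + card V * (a * b)"
    by (simp add: power2_eq_square sum.distrib sum_subtractf sum_distrib_left algebra_simps)
  finally have "(\<Sum>v\<in>V. (d v)\<^sup>2) \<le> (a + b) * sum d V - card V * (a * b)"
    by simp
  then have "4 * (a * b) * card V * (\<Sum>v\<in>V. (d v)\<^sup>2)
      \<le> 4 * (a * b) * card V * ((a + b) * sum d V - card V * (a * b))"
    by (rule mult_left_mono) (use assms in simp)
  \<comment> \<open>Completing the square; the subtracted square is then dropped.\<close>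
  also have "\<dots> = ((a + b) * sum d V)\<^sup>2 - ((a + b) * sum d V - 2 * card V * (a * b))\<^sup>2"
    by (simp add: power2_eq_square algebra_simps)
  finally show ?thesis
    by (smt (verit) zero_le_power2)
qed

section \<open>Simple graphs\<close>

context graph
begin

section \<open>Counting arcs, edges and neighbours\<close>

lemma card_arcs_ends: "card (arcs_ends G) = card (arcs G)"
  unfolding arcs_ends_def by (rule card_image) (rule inj_on_arc_to_ends)

lemma finite_arcs_ends: "finite (arcs_ends G)"
  unfolding arcs_ends_def by simp

text \<open>Forgetting orientation is two-to-one: the fibre over \<open>{u, v}\<close> consists of
  \<open>(u, v)\<close> and \<open>(v, u)\<close>, distinct as there are no loops.\<close>

lemma card_arcs_eq_edges: "card (arcs G) = 2 * card (edges G)"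
proof -
  let ?e = "\<lambda>(u, v). {u, v}"
  have edges: "edges G = ?e ` arcs_ends G"
    unfolding edges_def image_def by fastforce
  have fib: "card {p \<in> arcs_ends G. ?e p = E} = 2" if "E \<in> edges G" for E
  proof -
    from that obtain u v where E: "E = {u, v}" and uv: "u \<rightarrow> v"
      by (auto simp: edges_def)
    have vu: "v \<rightarrow> u"
      using uv by (rule graph_symmetric)
    have "{p \<in> arcs_ends G. ?e p = E} = {(u, v), (v, u)}"
    proof (intro equalityI subsetI)
      fix p assume "p \<in> {p \<in> arcs_ends G. ?e p = E}"
      then show "p \<in> {(u, v), (v, u)}"
        by (cases p) (simp add: E doubleton_eq_iff)
    next
      fix p assume "p \<in> {(u, v), (v, u)}"
      then have "p = (u, v) \<or> p = (v, u)"
        by simp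
      then show "p \<in> {p \<in> arcs_ends G. ?e p = E}"
        using uv vu by (elim disjE) (simp_all add: E insert_commute)
    qed
    moreover have "u \<noteq> v"
      using uv adj_not_same by blast
    ultimately show ?thesis
      by simp
  qed
  have "card (arcs_ends G) = (\<Sum>E\<in>?e ` arcs_ends G. card {p \<in> arcs_ends G. ?e p = E})"
    using sum.image_gen[OF finite_arcs_ends, of "\<lambda>_. 1::nat" ?e] by simp
  also have "\<dots> = 2 * card (edges G)"
    unfolding edges[symmetric] by (simp add: fib)
  finally show ?thesis
    by (simp add: card_arcs_ends)
qed

lemma sum_out_degree: "(\<Sum>v\<in>verts G. out_degree G v) = card (arcs G)"
proof -
  have "(\<Sum>v\<in>verts G. out_degree G v) = card (\<Union>v\<in>verts G. out_arcs G v)"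
    unfolding out_degree_def by (rule card_UN_disjoint[symmetric]) auto
  also have "(\<Union>v\<in>verts G. out_arcs G v) = arcs G"
    by auto
  finally show ?thesis .
qed

text \<open>Without parallel arcs, \<open>head\<close> is injective on the arcs leaving
  \<open>v\<close>.\<close>

lemma out_degree_eq_card_neighbours: "out_degree G v = card {w \<in> verts G. v \<rightarrow> w}"
proof -
  have "{w \<in> verts G. v \<rightarrow> w} = head G ` out_arcs G v"
    by (auto simp: arcs_ends_conv)
  moreover have "inj_on (head G) (out_arcs G v)"
    by (rule inj_onI) (auto intro: no_multi_arcs simp: arc_to_ends_def)
  ultimately show ?thesis
    by (simp add: out_degree_def card_image)
qed

section \<open>Complete graphs\<close>

lemma complete_digraph_iff:
  "complete_digraph (card (verts G)) G \<longleftrightarrow> (\<forall>u\<in>verts G. \<forall>v\<in>verts G. u \<noteq> v \<longrightarrow> u \<rightarrow> v)"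
proof -
  have "u \<in> verts G" "v \<in> verts G" "u \<noteq> v" if "u \<rightarrow> v" for u v
    using that adj_in_verts[OF that] adj_not_same by blast+
  then have "arcs_ends G \<subseteq> {(u, v). (u, v) \<in> verts G \<times> verts G \<and> u \<noteq> v}"
    by blast
  then show ?thesis
    unfolding complete_digraph_def set_eq_subset by (simp add: graph_axioms subset_eq) metis
qed

text \<open>Adjacency-or-equality is then transitive, so it coincides with reachability.\<close>

lemma complete_if_no_induced_path:
  assumes "connected G"
    and trans: "\<And>u v w. u \<rightarrow> v \<Longrightarrow> v \<rightarrow> w \<Longrightarrow> u \<noteq> w \<Longrightarrow> u \<rightarrow> w"
  shows "complete_digraph (card (verts G)) G"
  unfolding complete_digraph_iff
proof (intro ballI impI)
  fix u v assume uv: "u \<in> verts G" "v \<in> verts G" "u \<noteq> v"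
  have "strongly_connected G"
    using sym_arcs assms(1) by (rule symmetric_connected_imp_strongly_connected)
  then have "u \<rightarrow>\<^sup>* v"
    using uv by auto
  then have "u \<rightarrow>\<^sup>+ v"
    using uv by auto
  \<comment> \<open>The disjunct \<open>u = v\<close> keeps the induction going when the walk
    returns to its start.\<close>
  then have "u = v \<or> u \<rightarrow> v"
    by (induction rule: trancl_induct) (auto intro: trans)
  then show "u \<rightarrow> v"
    using uv by simp
qed

text \<open>Lets the equality case be argued by adjacency alone. Adjacency pulls back along an
  isomorphism; conversely, any bijection of the vertices with an initial segment of the naturals
  extends to the arcs.\<close>

lemma digraph_iso_complete_graph_iff:
  "digraph_iso G (complete_graph (card (verts G))) \<longleftrightarrow> complete_digraph (card (verts G)) G"
proof
  let ?n = "card (verts G)"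
  assume "digraph_iso G (complete_graph ?n)"
  then obtain f where f: "digraph_isomorphism f" and eq: "complete_graph ?n = app_iso f G"
    by (auto simp: digraph_iso_def)
  have K: "arcs_ends (complete_graph ?n) = {(i, j). i < ?n \<and> j < ?n \<and> i \<noteq> j}"
    "verts (complete_graph ?n) = {..<?n}"
    by (simp_all add: complete_graph_def)
  have inj: "inj_on (iso_verts f) (verts G)"
    using f by (rule digraph_isomorphism_inj_on_verts)
  show "complete_digraph ?n G"
    unfolding complete_digraph_iff
  proof (intro ballI impI)
    fix u v assume uv: "u \<in> verts G" "v \<in> verts G" "u \<noteq> v"
    then have "iso_verts f u \<in> {..<?n}" "iso_verts f v \<in> {..<?n}"
      unfolding K(2)[symmetric] eq by auto
    moreover have "iso_verts f u \<noteq> iso_verts f v"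
      using uv f by simp
    ultimately have "(iso_verts f u, iso_verts f v) \<in> arcs_ends (complete_graph ?n)"
      by (simp add: K)
    then obtain u' v' where "u' \<rightarrow> v'" "iso_verts f u = iso_verts f u'" "iso_verts f v = iso_verts f v'"
      unfolding eq arcs_ends_app_iso_eq[OF f] by auto
    then show "u \<rightarrow> v"
      using uv inj adj_in_verts by (metis inj_onD)
  qed
next
  let ?n = "card (verts G)"
  assume K: "complete_digraph ?n G"
  then have adj: "u \<rightarrow> v \<longleftrightarrow> u \<in> verts G \<and> v \<in> verts G \<and> u \<noteq> v" for u v
    by (auto simp: complete_digraph_def)
  obtain h where h: "bij_betw h (verts G) {..<?n}"
    using ex_bij_betw_finite_nat[of "verts G"] by (auto simp: atLeast0LessThan)
  then have inj: "inj_on h (verts G)"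
    by (rule bij_betw_imp_inj_on)
  \<comment> \<open>Arcs of \<open>complete_graph\<close> are pairs, so an arc goes to the pair of
    its relabelled ends, with \<open>fst\<close> and \<open>snd\<close> as new tail and head
    maps.\<close>
  define f where "f = \<lparr>iso_verts = h, iso_arcs = (\<lambda>a. (h (tail G a), h (head G a))),
    iso_head = snd, iso_tail = fst\<rparr>"
  have "inj_on (iso_arcs f) (arcs G)"
  proof (rule inj_onI)
    fix a b assume ab: "a \<in> arcs G" "b \<in> arcs G" and eq: "iso_arcs f a = iso_arcs f b"
    from eq have "h (tail G a) = h (tail G b)" "h (head G a) = h (head G b)"
      by (simp_all add: f_def)
    then have "arc_to_ends G a = arc_to_ends G b"
      unfolding arc_to_ends_def using ab by (auto intro: inj_onD[OF inj])
    then show "a = b"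
      using ab by (intro no_multi_arcs)
  qed
  then have f: "digraph_isomorphism f"
    unfolding digraph_isomorphism_def using inj wf_digraph by (auto simp: f_def)
  have "iso_arcs f ` arcs G = (\<lambda>(u, v). (h u, h v)) ` arcs_ends G"
    by (auto simp: f_def arcs_ends_conv image_image)
  also have "\<dots> = {(i, j). i < ?n \<and> j < ?n \<and> i \<noteq> j}"
  proof (intro equalityI subsetI)
    fix p assume "p \<in> (\<lambda>(u, v). (h u, h v)) ` arcs_ends G"
    then show "p \<in> {(i, j). i < ?n \<and> j < ?n \<and> i \<noteq> j}"
      using h inj by (auto simp: adj bij_betw_def dest: inj_onD)
  next
    fix p assume "p \<in> {(i, j). i < ?n \<and> j < ?n \<and> i \<noteq> j}"
    then obtain u v where "p = (h u, h v)" "u \<in> verts G" "v \<in> verts G" "u \<noteq> v"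
      using h by (auto simp: bij_betw_def) (metis imageE lessThan_iff)
    then show "p \<in> (\<lambda>(u, v). (h u, h v)) ` arcs_ends G"
      by (auto simp: adj)
  qed
  finally have arcs: "iso_arcs f ` arcs G = {(i, j). i < ?n \<and> j < ?n \<and> i \<noteq> j}" .
  have "complete_graph ?n = app_iso f G"
    unfolding complete_graph_def with_proj_def app_iso_def arcs
    using h by (simp add: f_def bij_betw_def)
  with f show "digraph_iso G (complete_graph ?n)"
    by (auto simp: digraph_iso_def)
qed

end

section \<open>The signless Laplacian spectrum\<close>

locale enumerated_graph = graph G for G :: "('a, 'b) pre_digraph" (structure) +
  fixes vs :: "'a list"
  assumes distinct_vs: "distinct vs" and set_vs: "set vs = verts G"
begin

abbreviation "n \<equiv> card (verts G)"
abbreviation "m \<equiv> card (edges G)"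
abbreviation "Q \<equiv> signless_laplacian_mat G vs"
abbreviation "deg v \<equiv> real (out_degree G v)"

text \<open>Nondecreasing, the reverse of \<open>signless_laplacian_eigenvalues\<close>, so that
  \<open>signless_L\<close> becomes a prefix sum.\<close>

definition spec :: "real list" where
  "spec = sorted_list_of_multiset (proots (char_poly Q))"

lemma length_vs: "length vs = n"
  using distinct_vs set_vs by (metis distinct_card)

lemma nth_vs_in_verts: "i < n \<Longrightarrow> vs ! i \<in> verts G"
  using set_vs length_vs by (metis nth_mem)

lemma nth_vs_eq_iff: "i < n \<Longrightarrow> j < n \<Longrightarrow> vs ! i = vs ! j \<longleftrightarrow> i = j"
  using distinct_vs length_vs by (metis nth_eq_iff_index_eq)

lemma bij_nth_vs: "bij_betw (\<lambda>i. vs ! i) {..<n} (verts G)"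
  using bij_betw_nth[OF distinct_vs] length_vs set_vs by metis

lemma ex_nth_vs: "v \<in> verts G \<Longrightarrow> \<exists>i<n. v = vs ! i"
  using set_vs length_vs by (metis in_set_conv_nth)

lemma sum_nth_vs: "(\<Sum>i<n. f (vs ! i)) = sum f (verts G)"
  by (rule sum.reindex_bij_betw[OF bij_nth_vs])

lemma Q_carrier: "Q \<in> carrier_mat n n"
  by (simp add: signless_laplacian_mat_def degree_mat_def adjacency_mat_def length_vs)

lemma Q_index:
  assumes "i < n" "j < n"
  shows "Q $$ (i, j) = (if i = j then deg (vs ! i) else if vs ! i \<rightarrow> vs ! j then 1 else 0)"
  using assms adj_not_same
  by (auto simp: signless_laplacian_mat_def degree_mat_def adjacency_mat_def length_vs)

lemma Q_sym: "i < n \<Longrightarrow> j < n \<Longrightarrow> Q $$ (i, j) = Q $$ (j, i)"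
  using graph_symmetric by (auto simp: Q_index)

lemma Q_nonneg: "i < n \<Longrightarrow> j < n \<Longrightarrow> Q $$ (i, j) \<ge> 0"
  by (simp add: Q_index)

lemma sum_adjacent: "(\<Sum>j<n. if v \<rightarrow> vs ! j then 1 else 0) = deg v"
  unfolding sum_nth_vs[of "\<lambda>w. if v \<rightarrow> w then 1 else 0"]
  by (simp add: out_degree_eq_card_neighbours Int_def flip: sum.inter_filter)

lemma sum_degrees: "(\<Sum>v\<in>verts G. deg v) = 2 * real m"
  using sum_out_degree card_arcs_eq_edges by (metis of_nat_mult of_nat_numeral of_nat_sum)

lemma trace_Q: "(\<Sum>i<n. Q $$ (i, i)) = 2 * real m"
  using sum_nth_vs[of deg] by (simp add: Q_index sum_degrees)

text \<open>Off-diagonal entries are 0 or 1, hence equal to their squares, and they add up to the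
  degree in each row.\<close>

lemma sum_squares_Q: "(\<Sum>i<n. \<Sum>j<n. (Q $$ (i, j))\<^sup>2) = (\<Sum>v\<in>verts G. (deg v)\<^sup>2) + 2 * real m"
proof -
  have "(\<Sum>j<n. (Q $$ (i, j))\<^sup>2) = (deg (vs ! i))\<^sup>2 + deg (vs ! i)" if "i < n" for i
  proof -
    have "(\<Sum>j<n. (Q $$ (i, j))\<^sup>2)
        = (\<Sum>j<n. (if j = i then (deg (vs ! i))\<^sup>2 else 0) + (if vs ! i \<rightarrow> vs ! j then 1 else 0))"
      using that adj_not_same by (intro sum.cong) (auto simp: Q_index)
    then show ?thesis
      using that by (simp add: sum.distrib sum_adjacent)
  qed
  then have "(\<Sum>i<n. \<Sum>j<n. (Q $$ (i, j))\<^sup>2) = (\<Sum>i<n. (deg (vs ! i))\<^sup>2 + deg (vs ! i))"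
    by simp
  also have "\<dots> = (\<Sum>v\<in>verts G. (deg v)\<^sup>2) + 2 * real m"
    unfolding sum_nth_vs[of "\<lambda>v. (deg v)\<^sup>2 + deg v"] by (simp add: sum.distrib sum_degrees)
  finally show ?thesis .
qed

text \<open>\<open>proots\<close> recovers the multiset of roots of a product of linear factors, so
  \<open>spec\<close> rearranges the real roots obtained by splitting.\<close>

lemma spec_char_poly: "char_poly Q = (\<Prod>e\<leftarrow>spec. [:- e, 1:])" and length_spec: "length spec = n"
proof -
  obtain es where es: "char_poly Q = (\<Prod>e\<leftarrow>es. [:- e, 1:])" "length es = n"
    using char_poly_real_symmetric_splits[OF Q_carrier Q_sym] by blast
  have "mset spec = mset es"
    by (simp add: spec_def es(1) proots_prod_linear_factors)
  then have "prod_mset (mset (map (\<lambda>e. [:- e, 1:]) spec)) = prod_mset (mset (map (\<lambda>e. [:- e, 1:]) es))"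
    by simp
  then show "char_poly Q = (\<Prod>e\<leftarrow>spec. [:- e, 1:])"
    unfolding es(1) prod_mset_prod_list by simp
  show "length spec = n"
    using \<open>mset spec = mset es\<close> es(2) by (metis mset_eq_length)
qed

sublocale symmetric_spectrum Q n spec
  by unfold_locales (use Q_carrier Q_sym spec_char_poly in auto)

lemma sum_spec: "(\<Sum>i<n. spec ! i) = 2 * real m"
  using sum_eigenvalues by (simp add: trace_Q sum_list_sum_nth length_spec atLeast0LessThan)

lemma sum_spec_squared: "(\<Sum>i<n. (spec ! i)\<^sup>2) = (\<Sum>v\<in>verts G. (deg v)\<^sup>2) + 2 * real m"
  using sum_eigenvalues_squared
  by (simp add: sum_squares_Q sum_list_sum_nth length_spec atLeast0LessThan)

lemma sorted_spec: "sorted spec"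
  by (simp add: spec_def)

text \<open>The eigenvalue numbered \<open>n - i\<close> from 1 sits at position
  \<open>n - i - 1\<close> of the reversed list, which is position \<open>i\<close> of
  \<open>spec\<close>.\<close>

lemma signless_L_eq: "k \<le> n \<Longrightarrow> signless_L G vs k = (\<Sum>i<k. spec ! i)"
  unfolding signless_L_def signless_q_def signless_laplacian_eigenvalues_def spec_def[symmetric]
  by (intro sum.cong) (auto simp: rev_nth length_spec)

text \<open>The quadratic relation makes \<open>Q * Q\<close> vanish at every off-diagonal zero of
  \<open>Q\<close>, whereas a path \<open>u\<close>, \<open>v\<close>, \<open>w\<close> contributes
  1 to that entry and no term is negative.\<close>

lemma complete_if_two_eigenvalues:
  assumes "connected G" and two: "\<And>e. e \<in> set spec \<Longrightarrow> e = s \<or> e = t"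
  shows "complete_digraph n G"
proof (rule complete_if_no_induced_path[OF assms(1)], rule ccontr)
  fix u v w assume uvw: "u \<rightarrow> v" "v \<rightarrow> w" "u \<noteq> w" "\<not> u \<rightarrow> w"
  obtain i j l where ijl: "i < n" "l < n" "j < n" "u = vs ! i" "v = vs ! l" "w = vs ! j"
    using uvw adj_in_verts ex_nth_vs by meson
  have "i \<noteq> l" "l \<noteq> j" "i \<noteq> j"
    using uvw ijl adj_not_same by auto
  then have Q: "Q $$ (i, l) = 1" "Q $$ (l, j) = 1" "Q $$ (i, j) = 0"
    using uvw ijl by (simp_all add: Q_index)
  have "(\<Sum>l<n. Q $$ (i, l) * Q $$ (l, j)) = 0"
    using index_quadratic_mat[OF Q_carrier \<open>i < n\<close> \<open>j < n\<close>, of s t] quadratic_annihilates_iff[of s t]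
      two ijl Q \<open>i \<noteq> j\<close> by (simp del: index_mult_mat)
  moreover have "Q $$ (i, l) * Q $$ (l, j) \<le> (\<Sum>l<n. Q $$ (i, l) * Q $$ (l, j))"
    by (rule member_le_sum) (use ijl Q_nonneg in auto)
  ultimately show False
    by (simp add: Q)
qed

lemma out_degree_complete:
  assumes "complete_digraph n G" "v \<in> verts G"
  shows "out_degree G v = n - 1"
proof -
  have "{w \<in> verts G. v \<rightarrow> w} = verts G - {v}"
    using assms by (auto simp: complete_digraph_def)
  then show ?thesis
    using assms by (simp add: out_degree_eq_card_neighbours)
qed

lemma edges_complete:
  assumes "complete_digraph n G"
  shows "2 * m = n * (n - 1)"
  using sum_out_degree card_arcs_eq_edges by (simp add: out_degree_complete[OF assms])

text \<open>\<open>Q\<close> is \<open>n - 2\<close> times the identity plus the all-ones matrix, so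
  only \<open>n - 2\<close> and \<open>2 * n - 2\<close> can occur; the trace leaves room for the
  larger value only once.\<close>

lemma spec_complete:
  assumes K: "complete_digraph n G" and i: "i < n - 1"
  shows "spec ! i = real n - 2"
proof (rule ccontr)
  assume ne: "spec ! i \<noteq> real n - 2"
  have Qe: "Q $$ (i, j) = (if i = j then real n - 2 else 0) + 1" if "i < n" "j < n" for i j
    using K that nth_vs_in_verts[OF that(1)] nth_vs_in_verts[OF that(2)] nth_vs_eq_iff[OF that]
    by (auto simp: Q_index out_degree_complete[OF K] of_nat_diff complete_digraph_def)
  have "(Q - (real n - 2) \<cdot>\<^sub>m 1\<^sub>m n) * (Q - (2 * real n - 2) \<cdot>\<^sub>m 1\<^sub>m n) = 0\<^sub>m n n"
  proof (rule eq_matI)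
    fix i j assume "i < dim_row (0\<^sub>m n n)" "j < dim_col (0\<^sub>m n n)"
    then have ij: "i < n" "j < n" by auto
    \<comment> \<open>The first factor is the all-ones matrix; each column of the second has one
      entry \<open>1 - n\<close> and otherwise ones, so it sums to 0.\<close>
    have "((Q - (real n - 2) \<cdot>\<^sub>m 1\<^sub>m n) * (Q - (2 * real n - 2) \<cdot>\<^sub>m 1\<^sub>m n)) $$ (i, j)
        = (\<Sum>l<n. 1 * (if l = j then 1 - real n else 1))"
      using Q_carrier ij
      by (simp add: scalar_prod_def atLeast0LessThan Qe) (intro sum.cong, auto)
    also have "\<dots> = (\<Sum>l<n. 1 - (if l = j then real n else 0))"
      by (rule sum.cong) auto
    also have "\<dots> = 0"
      using ij by (simp add: sum_subtractf)
    finally show "((Q - (real n - 2) \<cdot>\<^sub>m 1\<^sub>m n) * (Q - (2 * real n - 2) \<cdot>\<^sub>m 1\<^sub>m n)) $$ (i, j) = 0\<^sub>m n n $$ (i, j)"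
      using ij by simp
  qed (use Q_carrier in auto)
  then have two: "spec ! j = real n - 2 \<or> spec ! j = 2 * real n - 2" if "j < n" for j
    using that unfolding quadratic_annihilates_iff by (auto simp: length_spec)
  have "spec ! i \<le> spec ! (n - 1)"
    using i by (intro sorted_nth_mono[OF sorted_spec]) (auto simp: length_spec)
  then have top: "spec ! i = 2 * real n - 2" "spec ! (n - 1) = 2 * real n - 2"
    using i two[of i] two[of "n - 1"] ne by auto
  \<comment> \<open>All excesses over \<open>n - 2\<close> are nonnegative. The two top ones are
    \<open>n\<close> each, but the total is only \<open>n\<close>.\<close>
  have "(\<Sum>j\<in>{i, n - 1}. spec ! j - (real n - 2)) \<le> (\<Sum>j<n. spec ! j - (real n - 2))"
    by (rule sum_mono2) (use i two in fastforce)+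
  also have "\<dots> = 2 * real m - real n * (real n - 2)"
    by (simp add: sum_subtractf sum_spec)
  also have "2 * real m = real n * (real n - 1)"
    using arg_cong[OF edges_complete[OF K], of real] i by (simp add: of_nat_diff)
  finally show False
    using i top by (simp add: algebra_simps)
qed

text \<open>A walk to some second vertex must begin with an arc leaving \<open>v\<close>.\<close>

lemma out_degree_pos:
  assumes "connected G" "n \<ge> 2" "v \<in> verts G"
  shows "out_degree G v > 0"
proof -
  have "\<not> verts G \<subseteq> {v}"
    using assms card_mono[of "{v}" "verts G"] by auto
  then obtain u where u: "u \<in> verts G" "u \<noteq> v"
    by blast
  have "strongly_connected G"
    using sym_arcs assms(1) by (rule symmetric_connected_imp_strongly_connected)
  then have "v \<rightarrow>\<^sup>+ u"
    using assms u by auto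
  then obtain w where "v \<rightarrow> w"
    by (meson tranclD)
  then have "w \<in> {w \<in> verts G. v \<rightarrow> w}"
    using adj_in_verts by auto
  then show ?thesis
    unfolding out_degree_eq_card_neighbours by (auto simp: card_gt_0_iff)
qed

end

section \<open>The bound and its equality case\<close>

context enumerated_graph
begin

lemma signless_L_deviation:
  fixes k :: nat and L :: real
  assumes k: "0 < k" "k < n"
  defines "L \<equiv> signless_L G vs k"
  shows "k * (real n - k) * (n * ((\<Sum>v\<in>verts G. (deg v)\<^sup>2) + 2 * real m) - (2 * real m)\<^sup>2)
      - (n * L - k * (2 * real m))\<^sup>2
    = real n * k * (real n - k) * ((\<Sum>i<k. (spec ! i - L / k)\<^sup>2)
      + (\<Sum>i=k..<n. (spec ! i - (2 * real m - L) / (real n - k))\<^sup>2))"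
  using partial_sum_deviation[OF k, of "\<lambda>i. spec ! i"] k
  by (simp only: L_def signless_L_eq sum_spec sum_spec_squared less_imp_le_nat)

lemma signless_L_deviation_le:
  assumes k: "0 < k" "k < n"
  shows "(n * signless_L G vs k - k * (2 * real m))\<^sup>2
    \<le> k * (real n - k) * (n * ((\<Sum>v\<in>verts G. (deg v)\<^sup>2) + 2 * real m) - (2 * real m)\<^sup>2)"
proof -
  have "0 \<le> real n * k * (real n - k) * ((\<Sum>i<k. (spec ! i - signless_L G vs k / k)\<^sup>2)
      + (\<Sum>i=k..<n. (spec ! i - (2 * real m - signless_L G vs k) / (real n - k))\<^sup>2))"
    using k by (intro mult_nonneg_nonneg add_nonneg_nonneg sum_nonneg) auto
  then show ?thesis
    unfolding signless_L_deviation[OF k, symmetric] by linarith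
qed

text \<open>With zero defect each group of eigenvalues equals its mean, leaving at most two distinct
  values.\<close>

lemma complete_if_deviation_eq:
  assumes "connected G" and k: "0 < k" "k < n"
    and eq: "(n * signless_L G vs k - k * (2 * real m))\<^sup>2
      = k * (real n - k) * (n * ((\<Sum>v\<in>verts G. (deg v)\<^sup>2) + 2 * real m) - (2 * real m)\<^sup>2)"
  shows "complete_digraph n G"
proof -
  let ?s = "signless_L G vs k / k" and ?t = "(2 * real m - signless_L G vs k) / (real n - k)"
  have "real n * k * (real n - k) * ((\<Sum>i<k. (spec ! i - ?s)\<^sup>2) + (\<Sum>i=k..<n. (spec ! i - ?t)\<^sup>2)) = 0"
    unfolding signless_L_deviation[OF k, symmetric] eq by simp
  then have "(\<Sum>i<k. (spec ! i - ?s)\<^sup>2) + (\<Sum>i=k..<n. (spec ! i - ?t)\<^sup>2) = 0"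
    using k by auto
  then have "(\<Sum>i<k. (spec ! i - ?s)\<^sup>2) = 0" "(\<Sum>i=k..<n. (spec ! i - ?t)\<^sup>2) = 0"
    by (simp_all add: add_nonneg_eq_0_iff sum_nonneg)
  then have "\<forall>i<k. spec ! i = ?s" "\<forall>i\<in>{k..<n}. spec ! i = ?t"
    by (simp_all add: sum_nonneg_eq_0_iff)
  then have "e = ?s \<or> e = ?t" if "e \<in> set spec" for e
    using that by (metis atLeastLessThan_iff in_set_conv_nth length_spec not_le)
  then show ?thesis
    by (rule complete_if_two_eigenvalues[OF assms(1)])
qed

lemma signless_L_complete:
  assumes "complete_digraph n G" "k \<le> n - 1"
  shows "signless_L G vs k = k * (real n - 2)"
  using assms by (simp add: signless_L_eq spec_complete)

lemma signless_L_all: "signless_L G vs n = 2 * real m"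
  by (simp add: signless_L_eq sum_spec)

lemma degree_bounds:
  assumes "v \<in> verts G"
  shows "min_degree G \<le> out_degree G v" "out_degree G v \<le> max_degree G"
  using assms by (auto simp: min_degree_def max_degree_def)

text \<open>Makes the product of the extreme degrees positive, so that \<open>lower_bound\<close>
  divides by a nonzero root.\<close>

lemma min_degree_pos:
  assumes "connected G" "n \<ge> 2"
  shows "min_degree G > 0"
proof -
  have "verts G \<noteq> {}"
    using assms by auto
  then have "min_degree G \<in> out_degree G ` verts G"
    unfolding min_degree_def by (intro Min_in) auto
  then show ?thesis
    using out_degree_pos[OF assms] by auto
qed

lemma degrees_complete:
  assumes "complete_digraph n G" "n \<ge> 2"
  shows "max_degree G = n - 1" "min_degree G = n - 1"
proof -
  have "verts G \<noteq> {}"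
    using assms(2) by auto
  then have "out_degree G ` verts G = {n - 1}"
    by (simp add: out_degree_complete[OF assms(1)] image_constant_conv cong: image_cong_simp)
  then show "max_degree G = n - 1" "min_degree G = n - 1"
    by (simp_all add: max_degree_def min_degree_def)
qed

definition lower_bound :: "nat \<Rightarrow> real" where
  "lower_bound k = 2 * real m * real k / real n
    - sqrt (real m * real k * (real n - real k)
        * (2 * real (max_degree G) * real (min_degree G) * (real n - 2 * real m)
          + real m * (real (max_degree G) + real (min_degree G))\<^sup>2))
      / (real n * sqrt (real (max_degree G) * real (min_degree G)))"

text \<open>With both extreme degrees \<open>n - 1\<close> and \<open>2 * m = n * (n - 1)\<close>, a
  factor \<open>(n * (n - 1))\<^sup>2\<close> leaves the root and cancels the denominator.\<close>

lemma lower_bound_complete: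
  assumes K: "complete_digraph n G" and n: "n \<ge> 2" and k: "k \<le> n"
  shows "lower_bound k = k * (real n - 1) - sqrt ((real n - 1) * k * (real n - k))"
proof -
  have m: "2 * real m = real n * (real n - 1)"
    using arg_cong[OF edges_complete[OF K], of real] n by (simp add: of_nat_diff)
  then have m': "real m = real n * (real n - 1) / 2"
    by simp
  let ?D = "real n - 1"
  have "real m * k * (real n - k) * (2 * ?D * ?D * (real n - 2 * real m) + real m * (?D + ?D)\<^sup>2)
      = (n * ?D)\<^sup>2 * (?D * k * (real n - k))"
    unfolding m' by (simp add: power2_eq_square field_simps)
  then have "sqrt (real m * k * (real n - k) * (2 * ?D * ?D * (real n - 2 * real m) + real m * (?D + ?D)\<^sup>2))
      = sqrt ((n * ?D)\<^sup>2 * (?D * k * (real n - k)))"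
    by (rule arg_cong)
  also have "\<dots> = n * ?D * sqrt (?D * k * (real n - k))"
    using n by (simp add: real_sqrt_mult)
  finally have "sqrt (real m * k * (real n - k) * (2 * ?D * ?D * (real n - 2 * real m) + real m * (?D + ?D)\<^sup>2))
      = n * ?D * sqrt (?D * k * (real n - k))" .
  moreover have "sqrt (?D * ?D) = ?D"
    using n by simp
  moreover have "2 * real m * k / n = k * ?D"
    using n by (auto simp: m)
  ultimately show ?thesis
    using n by (auto simp: lower_bound_def degrees_complete[OF K n] of_nat_diff)
qed

lemma signless_L_eq_lower_bound_complete:
  assumes K: "complete_digraph n G" and n: "n \<ge> 2" and k: "1 \<le> k" "k \<le> n - 1"
  shows "signless_L G vs k = lower_bound k \<longleftrightarrow> k = n - 1"
proof -
  have "k \<le> n" "real k \<le> real n - 1" "real k > 0"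
    using k n by auto
  have "signless_L G vs k = lower_bound k \<longleftrightarrow> sqrt ((real n - 1) * k * (real n - k)) = k"
    unfolding signless_L_complete[OF K k(2)] lower_bound_complete[OF K n \<open>k \<le> n\<close>]
    by (auto simp: algebra_simps)
  also have "\<dots> \<longleftrightarrow> (real n - 1) * k * (real n - k) = (real k)\<^sup>2"
    using \<open>real k > 0\<close> by (metis less_imp_le real_sqrt_eq_iff real_sqrt_unique real_sqrt_abs abs_of_pos)
  \<comment> \<open>The difference of the two sides factors, since
    \<open>(n - 1) * (n - k) - k = n * (n - 1 - k)\<close>.\<close>
  also have "\<dots> \<longleftrightarrow> k * (n * (real n - 1 - k)) = 0"
    by (simp add: power2_eq_square algebra_simps)
  also have "\<dots> \<longleftrightarrow> k = n - 1"
    using k n by (auto simp: of_nat_diff)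
  finally show ?thesis .
qed

text \<open>Both claims rest on one chain: \<open>D * d * dev\<^sup>2\<close> is at most
  \<open>D * d * k * (n - k) * V\<close>, which is at most \<open>m * k * (n - k) * W\<close>.
  Equality of the ends forces it in the first link, hence completeness.\<close>

lemma
  assumes conn: "connected G" and n: "n \<ge> 2" and k: "1 \<le> k" "k \<le> n - 1"
  shows lower_bound_le_signless_L: "lower_bound k \<le> signless_L G vs k"
    and complete_if_signless_L_eq_lower_bound:
      "signless_L G vs k = lower_bound k \<Longrightarrow> complete_digraph n G"
proof -
  define D d where "D = real (max_degree G)" and "d = real (min_degree G)"
  define V where "V = n * ((\<Sum>v\<in>verts G. (deg v)\<^sup>2) + 2 * real m) - (2 * real m)\<^sup>2"
  define W where "W = 2 * D * d * (real n - 2 * real m) + real m * (D + d)\<^sup>2"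
  define dev where "dev = k * (2 * real m) - n * signless_L G vs k"
  define r where "r = sqrt (real m * k * (real n - k) * W)"
  have k': "0 < k" "k < n"
    using k n by auto
  obtain v where v: "v \<in> verts G"
    using n by fastforce
  have "d > 0" "d \<le> D"
    using min_degree_pos[OF conn n] degree_bounds[OF v] by (auto simp: d_def D_def)
  then have p: "D * d > 0"
    by simp
  have "4 * (d * D) * n * (\<Sum>v\<in>verts G. (deg v)\<^sup>2) \<le> ((d + D) * (\<Sum>v\<in>verts G. deg v))\<^sup>2"
    by (rule sum_squares_le_of_bounds) (use \<open>d > 0\<close> \<open>d \<le> D\<close> degree_bounds in \<open>auto simp: d_def D_def\<close>)
  \<comment> \<open>The degree inequality divided by 4, with the terms common to \<open>V\<close>
    and \<open>W\<close> added.\<close>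
  then have VW: "D * d * V \<le> m * W"
    unfolding V_def W_def sum_degrees by (simp add: power2_eq_square algebra_simps)
  have dev: "dev\<^sup>2 \<le> k * (real n - k) * V"
    using signless_L_deviation_le[OF k'] unfolding V_def dev_def by (simp add: power2_commute)
  have "D * d * dev\<^sup>2 \<le> D * d * (k * (real n - k) * V)"
    using dev p by (intro mult_left_mono) auto
  also have "\<dots> = k * (real n - k) * (D * d * V)"
    by simp
  also have "\<dots> \<le> k * (real n - k) * (m * W)"
    using VW k' by (intro mult_left_mono) auto
  finally have le2: "D * d * (k * (real n - k) * V) \<le> real m * k * (real n - k) * W"
    and le: "D * d * dev\<^sup>2 \<le> real m * k * (real n - k) * W"
    using VW k' by (auto simp: mult.assoc mult.left_commute intro: mult_left_mono)
  \<comment> \<open>A real number whose square is at most \<open>x\<close> is at most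
    \<open>sqrt x\<close>, whatever its sign.\<close>
  have "sqrt (D * d) * dev \<le> r"
    unfolding r_def by (rule real_le_rsqrt) (use le p in \<open>simp add: power_mult_distrib\<close>)
  then have "dev \<le> r / sqrt (D * d)"
    using p by (simp add: field_simps)
  moreover have lb: "lower_bound k = 2 * real m * k / n - r / (n * sqrt (D * d))"
    by (simp only: lower_bound_def r_def W_def D_def d_def)
  \<comment> \<open>Up to the factor \<open>n\<close>, the slack in the theorem is the slack in the
    bound on \<open>dev\<close>; this settles both the inequality and equality.\<close>
  have gap: "signless_L G vs k - lower_bound k = (r / sqrt (D * d) - dev) / n"
    using v unfolding lb dev_def by (auto simp: diff_divide_distrib ac_simps)
  ultimately have "0 \<le> signless_L G vs k - lower_bound k"
    by simp
  then show "lower_bound k \<le> signless_L G vs k"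
    by simp
  assume "signless_L G vs k = lower_bound k"
  then have "dev = r / sqrt (D * d)"
    using gap v by auto
  then have "sqrt (D * d) * dev = r"
    using p by auto
  then have "(sqrt (D * d) * dev)\<^sup>2 = r\<^sup>2"
    by simp
  \<comment> \<open>Real \<open>sqrt\<close> is odd in Isabelle, so \<open>r\<^sup>2\<close> is the
    radicand only once that is known to be nonnegative.\<close>
  moreover have "0 \<le> real m * k * (real n - k) * W"
    using le p by (smt (verit) mult_nonneg_nonneg zero_le_power2)
  ultimately have "D * d * dev\<^sup>2 = real m * k * (real n - k) * W"
    using p by (simp add: power_mult_distrib r_def)
  \<comment> \<open>The middle of the chain is squeezed between equal ends; the positive factor
    \<open>D * d\<close> cancels.\<close>
  then have "dev\<^sup>2 \<ge> k * (real n - k) * V"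
    using le2 p by (metis mult_le_cancel_left_pos)
  then have "dev\<^sup>2 = k * (real n - k) * V"
    using dev by simp
  then show "complete_digraph n G"
    by (intro complete_if_deviation_eq[OF conn k']) (simp add: dev_def V_def power2_commute)
qed

end

theorem theorem6:
  fixes G :: "('a, 'b) pre_digraph"
    and vs :: "'a list"
    and n m :: nat
    and \<Delta> \<delta> :: real
    and B :: "nat \<Rightarrow> real"
  assumes "graph G"
    and "Digraph_Component.connected G"
    and "distinct vs" and "set vs = verts G"
    and "n = card (verts G)" and "n \<ge> 2"
    and "m = card (edges G)"
    and "\<Delta> = real (max_degree G)"
    and "\<delta> = real (min_degree G)"
    and "\<And>k. B k = 2 * real m * real k / real n
           - sqrt (real m * real k * (real n - real k)
                   * (2 * \<Delta> * \<delta> * (real n - 2 * real m) + real m * (\<Delta> + \<delta>)\<^sup>2))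
             / (real n * sqrt (\<Delta> * \<delta>))"
  shows "(\<forall>k. 1 \<le> k \<and> k \<le> n - 1 \<longrightarrow>
            signless_L G vs k \<ge> B k
          \<and> (signless_L G vs k = B k \<longleftrightarrow> digraph_iso G (complete_graph n) \<and> k = n - 1))
       \<and> signless_L G vs n = 2 * real m \<and> B n = 2 * real m"
proof -
  interpret enumerated_graph G vs
    using assms(1,3,4) by (simp add: enumerated_graph_def enumerated_graph_axioms_def)
  have B: "B = lower_bound"
    by (rule ext) (simp add: assms(5,7-10) lower_bound_def)
  have n: "card (verts G) \<ge> 2"
    using assms(5,6) by simp
  \<comment> \<open>At \<open>k = n\<close> the factor \<open>n - k\<close> annihilates the
    root.\<close>
  have "lower_bound (card (verts G)) = 2 * real (card (edges G))"
    using n by (auto simp: lower_bound_def)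
  then show ?thesis
    unfolding B assms(5,7) digraph_iso_complete_graph_iff
    using lower_bound_le_signless_L[OF assms(2) n] signless_L_all
      complete_if_signless_L_eq_lower_bound[OF assms(2) n]
      signless_L_eq_lower_bound_complete[OF _ n] by blast
qed

end
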